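(* Let $G\in\mathbb{R}^{n\times n}$ be an irreducible stochastic matrix, let $\hat\mu\in\mathbb{R}^n$ with $\hat\mu>0$ and $\hat\mu^\top\mathbf{1}_n=1$, and let $\Omega\subseteq\{(i,j):1\le i,j\le n\}$. Consider the linear optimization problem (LP) and the $\ell_1$-TSDP with support constraint (P), both associated with $(G,\hat\mu,\Omega)$ and defined in the context. If (LP) is feasible, there exists an optimal solution $\mathbf{x}^*$ of (LP) such that $$|\mathrm{supp}(\mathbf{x}^* )|\le\min\big(|\Omega|,\ |\mathrm{supp}(G)\cap\Omega|+2n\big).$$ Equivalently, if (P) is feasible, there exists an optimal solution $\Delta^*$ of (P) such that $$|\mathrm{supp}(\Delta^* )|\le\min\big(|\Omega|,\ |\mathrm{supp}(G)\cap\Omega|+2n\big).$$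
   Context: All inequalities between vectors and matrices are entrywise. $\mathbf{0}_n,\mathbf{1}_n$ are the all-zeros and all-ones vectors in $\mathbb{R}^n$. A matrix $G\in\mathbb{R}^{n\times n}$ is stochastic if $G\ge 0$ and $G\mathbf{1}_n=\mathbf{1}_n$. It is irreducible if there is no partition of $\{1,\dots,n\}$ into two nonempty disjoint sets $\mathcal I,\mathcal J$ with $G_{i,j}=0$ for all $i\in\mathcal I$, $j\in\mathcal J$. The support $\mathrm{supp}(\cdot)$ of a matrix (or vector) is the set of indices of its non-zero entries; $|S|$ is the cardinality of a set $S$; $\|\Delta\|_1=\sum_{i,j}|\Delta_{i,j}|$. Problem (P) is: $\min_{\Delta\in\mathbb{R}^{n\times n}}\|\Delta\|_1$ subject to $\Delta\mathbf{1}_n=\mathbf{0}_n$, $\hat\mu^\top\Delta=\hat\mu^\top(I-G)$, $\Delta+G\ge0$, and $\Delta_{i,j}=0$ for $(i,j)\notin\Omega$. Problem (LP) is its reformulation obtained by writing $\Delta=\Delta^0+\Delta^+-\Delta^-$ with nonnegative terms. Let $\Omega^0=\Omega\setminus\mathrm{supp}(G)$, $\Omega^{\pm}=\Omega\cap\mathrm{supp}(G)$, $p^0=|\Omega^0|$, $p^\pm=|\Omega^\pm|$, $p=p^0+2p^\pm$. The variable is $\mathbf{x}=(\mathbf{x}^0,\mathbf{x}^+,\mathbf{x}^-)\in\mathbb{R}^p$, where $\mathbf{x}^0\in\mathbb{R}^{p^0}$ collects the entries of $\Delta^0$ indexed by $\Omega^0$, and $\mathbf{x}^+,\mathbf{x}^-\in\mathbb{R}^{p^\pm}$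 collect the entries of $\Delta^+,\Delta^-$ indexed by $\Omega^\pm$ (all other entries of $\Delta^0,\Delta^+,\Delta^-$ are zero). Problem (LP) is: minimize $\mathbf{1}_p^\top\mathbf{x}$ subject to $A\mathbf{x}=\mathbf{b}$, $\mathbf{x}\ge0$, $\mathbf{x}^-\le\mathbf{g}$, where $\mathbf{g}\in\mathbb{R}^{p^\pm}$ collects the entries $G_{i,j}$, $(i,j)\in\Omega^\pm$, and $A\mathbf{x}=\mathbf{b}$ (with $A\in\mathbb{R}^{2n\times p}$) is the system of the $2n$ linear equalities $(\Delta^0+\Delta^+-\Delta^-)\mathbf{1}_n=\mathbf{0}_n$ and $\hat\mu^\top(\Delta^0+\Delta^+-\Delta^-)=\hat\mu^\top(I-G)$. *)

theory Defs
  imports "HOL-Analysis.Analysis"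
begin

definition stochastic :: "real^'n^'n \<Rightarrow> bool" where
  "stochastic G \<longleftrightarrow> (\<forall>i j. 0 \<le> G $ i $ j) \<and> G *v 1 = 1"

definition irreducible_mat :: "real^'n^'n \<Rightarrow> bool" where
  "irreducible_mat G \<longleftrightarrow>
     \<not> (\<exists>I J. I \<noteq> {} \<and> J \<noteq> {} \<and> I \<inter> J = {} \<and> I \<union> J = UNIV \<and>
            (\<forall>i\<in>I. \<forall>j\<in>J. G $ i $ j = 0))"

definition supp_mat :: "real^'n^'n \<Rightarrow> ('n \<times> 'n) set" where
  "supp_mat M = {(i, j). M $ i $ j \<noteq> 0}"

definition norm1_mat :: "real^'n^'n \<Rightarrow> real" where
  "norm1_mat M = (\<Sum>i\<in>UNIV. \<Sum>j\<in>UNIV. \<bar>M $ i $ j\<bar>)"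


text \<open>On vectors, \<open>1\<close> is the all-ones vector; on matrices the identity is \<open>mat 1\<close>
  (\<open>1\<close> would be the all-ones matrix).\<close>

definition P_feasible ::
  "real^'n^'n \<Rightarrow> real^'n \<Rightarrow> ('n \<times> 'n) set \<Rightarrow> real^'n^'n \<Rightarrow> bool" where
  "P_feasible G \<mu> \<Omega> D \<longleftrightarrow>
     D *v 1 = 0 \<and>
     \<mu> v* D = \<mu> v* (mat 1 - G) \<and>
     (\<forall>i j. 0 \<le> (D + G) $ i $ j) \<and>
     (\<forall>i j. (i, j) \<notin> \<Omega> \<longrightarrow> D $ i $ j = 0)"

definition P_optimal ::
  "real^'n^'n \<Rightarrow> real^'n \<Rightarrow> ('n \<times> 'n) set \<Rightarrow> real^'n^'n \<Rightarrow> bool" where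
  "P_optimal G \<mu> \<Omega> = is_arg_min norm1_mat (P_feasible G \<mu> \<Omega>)"


definition Omega_zero :: "real^'n^'n \<Rightarrow> ('n \<times> 'n) set \<Rightarrow> ('n \<times> 'n) set" where
  "Omega_zero G \<Omega> = \<Omega> - supp_mat G"

definition Omega_pm :: "real^'n^'n \<Rightarrow> ('n \<times> 'n) set \<Rightarrow> ('n \<times> 'n) set" where
  "Omega_pm G \<Omega> = \<Omega> \<inter> supp_mat G"

text \<open>The size \<open>p = p\<^sup>0 + 2 p\<^sup>\<plusminus>\<close> of the (LP) variable depends on \<open>G\<close> and \<open>\<Omega>\<close>, so a vector of
  \<open>\<real>\<^sup>p\<close> is a function on the \<open>p\<close>-element index set \<open>lp_index G \<Omega>\<close>, taken \<open>extensional\<close> so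
  that it has no content elsewhere. The constructors tag the blocks
  \<open>x\<^sup>0\<close>, \<open>x\<^sup>+\<close> and \<open>x\<^sup>-\<close>.\<close>

datatype 'n lp_var = VZero "'n \<times> 'n" | VPlus "'n \<times> 'n" | VMinus "'n \<times> 'n"

definition lp_index :: "real^'n^'n \<Rightarrow> ('n \<times> 'n) set \<Rightarrow> 'n lp_var set" where
  "lp_index G \<Omega> =
     VZero ` Omega_zero G \<Omega> \<union> VPlus ` Omega_pm G \<Omega> \<union> VMinus ` Omega_pm G \<Omega>"

definition Delta_zero ::
  "real^'n^'n \<Rightarrow> ('n \<times> 'n) set \<Rightarrow> ('n lp_var \<Rightarrow> real) \<Rightarrow> real^'n^'n" where
  "Delta_zero G \<Omega> x = (\<chi> i j. if (i, j) \<in> Omega_zero G \<Omega> then x (VZero (i, j)) else 0)"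

definition Delta_plus ::
  "real^'n^'n \<Rightarrow> ('n \<times> 'n) set \<Rightarrow> ('n lp_var \<Rightarrow> real) \<Rightarrow> real^'n^'n" where
  "Delta_plus G \<Omega> x = (\<chi> i j. if (i, j) \<in> Omega_pm G \<Omega> then x (VPlus (i, j)) else 0)"

definition Delta_minus ::
  "real^'n^'n \<Rightarrow> ('n \<times> 'n) set \<Rightarrow> ('n lp_var \<Rightarrow> real) \<Rightarrow> real^'n^'n" where
  "Delta_minus G \<Omega> x = (\<chi> i j. if (i, j) \<in> Omega_pm G \<Omega> then x (VMinus (i, j)) else 0)"

definition LP_feasible ::
  "real^'n^'n \<Rightarrow> real^'n \<Rightarrow> ('n \<times> 'n) set \<Rightarrow> ('n lp_var \<Rightarrow> real) \<Rightarrow> bool" where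
  "LP_feasible G \<mu> \<Omega> x \<longleftrightarrow>
     x \<in> extensional (lp_index G \<Omega>) \<and>
     (Delta_zero G \<Omega> x + Delta_plus G \<Omega> x - Delta_minus G \<Omega> x) *v 1 = 0 \<and>
     \<mu> v* (Delta_zero G \<Omega> x + Delta_plus G \<Omega> x - Delta_minus G \<Omega> x) = \<mu> v* (mat 1 - G) \<and>
     (\<forall>k\<in>lp_index G \<Omega>. 0 \<le> x k) \<and>
     (\<forall>(i, j)\<in>Omega_pm G \<Omega>. x (VMinus (i, j)) \<le> G $ i $ j)"

definition LP_objective ::
  "real^'n^'n \<Rightarrow> ('n \<times> 'n) set \<Rightarrow> ('n lp_var \<Rightarrow> real) \<Rightarrow> real" where
  "LP_objective G \<Omega> x = (\<Sum>k\<in>lp_index G \<Omega>. x k)"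

definition LP_optimal ::
  "real^'n^'n \<Rightarrow> real^'n \<Rightarrow> ('n \<times> 'n) set \<Rightarrow> ('n lp_var \<Rightarrow> real) \<Rightarrow> bool" where
  "LP_optimal G \<mu> \<Omega> = is_arg_min (LP_objective G \<Omega>) (LP_feasible G \<mu> \<Omega>)"

definition supp_lp ::
  "real^'n^'n \<Rightarrow> ('n \<times> 'n) set \<Rightarrow> ('n lp_var \<Rightarrow> real) \<Rightarrow> 'n lp_var set" where
  "supp_lp G \<Omega> x = {k \<in> lp_index G \<Omega>. x k \<noteq> 0}"

end

theory Submission
  imports Defs
begin

text \<open>The bound is a vertex argument. A linear program with box constraints and positive costs
  attains its optimum, because bounding the cost bounds every variable. Among its optimal
  solutions take one with as few variables as possible strictly between their bounds. If more of
  them were strictly between their bounds than the dimension \<open>m\<close> of the space in which the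
  equality constraints live, the corresponding columns would satisfy a linear relation, and moving
  along it, in the direction that does not increase the cost, would push one more variable to a
  bound (\<open>fewer_interior_indices\<close>). So at most \<open>m\<close> variables are strictly between their bounds
  (\<open>basic_box_optimum\<close>).

  In (LP) there are \<open>2n\<close> equality constraints, and only the entries of \<open>x\<^sup>-\<close> have a finite upper
  bound. A nonzero variable is either strictly between its bounds or an entry of \<open>x\<^sup>-\<close> at its
  bound, and there are as many entries of \<open>x\<^sup>-\<close> as positions in \<open>\<Omega> \<inter> supp G\<close>; this is the bound
  \<open>|supp G \<inter> \<Omega>| + 2n\<close>.

  The bound \<open>|\<Omega>|\<close> holds for every optimal solution. Splitting a matrix into its positive and negative
  parts turns a feasible point of (P) into a feasible point of (LP) whose cost is the 1-norm,
  while assembling the matrix from a feasible point of (LP) never increases the cost. So the two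
  problems have the same optimal value, and an optimal point of (LP) loses nothing when it is
  assembled. By the triangle inequality this forces one of \<open>x\<^sup>+\<close> and \<open>x\<^sup>-\<close> to vanish at each position
  (\<open>LP_optimal_complementary\<close>), so at most one variable per position of \<open>\<Omega>\<close> is nonzero. The
  assembled matrix is then optimal for (P), and its support is no larger.\<close>

section \<open>Linear programs with bounded variables\<close>

text \<open>The columns \<open>a k\<close> of the constraint matrix are vectors of an abstract space, so that the
  number of equality constraints is the dimension of a type. Only the variables in \<open>B\<close> have an
  upper bound.\<close>

definition box_feasible ::
  "'k set \<Rightarrow> 'k set \<Rightarrow> ('k \<Rightarrow> real) \<Rightarrow> ('k \<Rightarrow> 'v::real_vector) \<Rightarrow> 'v \<Rightarrow> ('k \<Rightarrow> real) \<Rightarrow> bool" where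
  "box_feasible I B u a b x \<longleftrightarrow>
     x \<in> extensional I \<and> (\<Sum>k\<in>I. x k *\<^sub>R a k) = b \<and>
     (\<forall>k\<in>I. 0 \<le> x k) \<and> (\<forall>k\<in>B. x k \<le> u k)"

definition interior_indices :: "'k set \<Rightarrow> 'k set \<Rightarrow> ('k \<Rightarrow> real) \<Rightarrow> ('k \<Rightarrow> real) \<Rightarrow> 'k set" where
  "interior_indices I B u x = {k \<in> I. 0 < x k \<and> (k \<in> B \<longrightarrow> x k < u k)}"

text \<open>Positive costs make the feasible points that cost no more than \<open>x0\<close> a compact set, on which the
  continuous objective attains its minimum.\<close>

lemma box_optimum_exists:
  fixes a :: "'k \<Rightarrow> 'v::real_normed_vector"
  assumes fin: "finite I"
    and pos: "\<And>k. k \<in> I \<Longrightarrow> 0 < c k"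
    and x0: "box_feasible I B u a b x0"
  obtains x where "is_arg_min (\<lambda>x. \<Sum>k\<in>I. c k * x k) (box_feasible I B u a b) x"
proof -
  let ?f = "\<lambda>x. \<Sum>k\<in>I. c k * x k"
  \<comment> \<open>The feasible points that matter lie in \<open>C\<close>; the factor \<open>{undefined}\<close> encodes extensionality.\<close>
  define C where "C = (\<Pi>\<^sub>E k\<in>UNIV. if k \<in> I then {0..?f x0 / c k} else {undefined})"
  define K where "K = C \<inter> {x. (\<Sum>k\<in>I. x k *\<^sub>R a k) = b} \<inter> (\<Inter>k\<in>B. {x. x k \<le> u k})"
  have coord: "continuous_on S (\<lambda>x::'k \<Rightarrow> real. x k)" for S k
    by (rule continuous_on_subset[OF continuous_on_product_coordinates]) simp
  have "compactin (product_topology (\<lambda>_. euclidean) UNIV) C"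
    unfolding C_def compactin_PiE by auto
  then have "compact C"
    by (simp add: euclidean_product_topology)
  moreover have "closed {x::'k \<Rightarrow> real. (\<Sum>k\<in>I. x k *\<^sub>R a k) = b}"
    by (intro closed_Collect_eq continuous_intros coord)
  moreover have "closed (\<Inter>k\<in>B. {x::'k \<Rightarrow> real. x k \<le> u k})"
    by (intro closed_INT ballI closed_Collect_le continuous_intros coord)
  ultimately have "compact K"
    unfolding K_def by (intro compact_Int_closed)
  have inK: "x \<in> K" if x: "box_feasible I B u a b x" and le: "?f x \<le> ?f x0" for x
  proof -
    have "x k \<le> ?f x0 / c k" if k: "k \<in> I" for k
    proof -
      have "c k * x k \<le> ?f x"
        using x pos fin k unfolding box_feasible_def
        by (intro member_le_sum) (simp_all add: less_imp_le)
      with le show ?thesis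
        using pos[OF k] by (simp add: field_simps)
    qed
    with x show ?thesis
      unfolding K_def C_def box_feasible_def by (auto simp: extensional_def)
  qed
  have outK: "box_feasible I B u a b x" if "x \<in> K" for x
  proof -
    have "x k \<in> (if k \<in> I then {0..?f x0 / c k} else {undefined})" for k
      using that unfolding K_def C_def by blast
    then have "x \<in> extensional I" "\<forall>k\<in>I. 0 \<le> x k"
      by (auto simp: extensional_def split: if_splits) (metis atLeastAtMost_iff singletonD)+
    then show ?thesis
      using that unfolding K_def box_feasible_def by auto
  qed
  have "continuous_on K ?f"
    by (intro continuous_intros coord)
  with \<open>compact K\<close> inK[OF x0] obtain x where x: "x \<in> K" "\<forall>y\<in>K. ?f x \<le> ?f y"
    using continuous_attains_inf[of K ?f] by auto
  have "?f x \<le> ?f y" if "box_feasible I B u a b y" for y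
    using x inK[OF that] inK[OF x0] by (meson linear order_trans order_refl)
  with outK[OF x(1)] show ?thesis
    by (intro that[of x]) (auto simp: is_arg_min_linorder)
qed

text \<open>For an injective family this is the dimension bound on independent sets; a repeated vector gives
  the relation \<open>a k - a l = 0\<close>, which the set of values does not see.\<close>

lemma linear_relation_of_large_family:
  fixes a :: "'k \<Rightarrow> 'v::euclidean_space"
  assumes fin: "finite F" and card: "DIM('v) < card F"
  obtains d where "\<And>k. k \<notin> F \<Longrightarrow> d k = 0" "(\<Sum>k\<in>F. d k *\<^sub>R a k) = 0" "\<exists>k\<in>F. d k \<noteq> 0"
proof (cases "inj_on a F")
  case True
  then have "dependent (a ` F)"
    using fin card by (intro dependent_biggerset) (simp add: card_image)
  then obtain w where w: "\<exists>v\<in>a ` F. w v \<noteq> 0" "(\<Sum>v\<in>a ` F. w v *\<^sub>R v) = 0"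
    using fin by (auto simp: real_vector.dependent_finite)
  have "(\<Sum>k\<in>F. w (a k) *\<^sub>R a k) = 0"
    using w(2) True by (simp add: sum.reindex)
  then show ?thesis
    using w(1) by (intro that[of "\<lambda>k. if k \<in> F then w (a k) else 0"]) auto
next
  case False
  then obtain k l where kl: "k \<in> F" "l \<in> F" "k \<noteq> l" "a k = a l"
    by (auto simp: inj_on_def)
  let ?d = "\<lambda>m. if m = k then 1 else if m = l then -1 else 0 :: real"
  have "(\<Sum>m\<in>F. ?d m *\<^sub>R a m) = (\<Sum>m\<in>{k, l}. ?d m *\<^sub>R a m)"
    using kl fin by (intro sum.mono_neutral_right) auto
  also have "\<dots> = 0"
    using kl by auto
  finally show ?thesis
    using kl by (intro that[of ?d]) auto
qed

text \<open>The step along a linear relation between the columns of the interior variables. Oriented so that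
  the cost does not increase, the relation has a negative coefficient, since the costs are
  positive; hence the ray leaves the feasible set, and at the last feasible point an interior
  variable has reached a bound.\<close>

lemma fewer_interior_indices:
  fixes a :: "'k \<Rightarrow> 'v::euclidean_space"
  assumes fin: "finite I"
    and pos: "\<And>k. k \<in> I \<Longrightarrow> 0 < c k"
    and x: "box_feasible I B u a b x"
    and large: "DIM('v) < card (interior_indices I B u x)"
  obtains y where "box_feasible I B u a b y" "(\<Sum>k\<in>I. c k * y k) \<le> (\<Sum>k\<in>I. c k * x k)"
    "card (interior_indices I B u y) < card (interior_indices I B u x)"
proof -
  define F where "F = interior_indices I B u x"
  have FI: "F \<subseteq> I" and finF: "finite F"
    using fin by (auto simp: F_def interior_indices_def)
  have F: "0 < x k" "k \<in> B \<Longrightarrow> x k < u k" if "k \<in> F" for k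
    using that by (auto simp: F_def interior_indices_def)
  obtain d0 where d0: "\<And>k. k \<notin> F \<Longrightarrow> d0 k = 0" "(\<Sum>k\<in>F. d0 k *\<^sub>R a k) = 0" "\<exists>k\<in>F. d0 k \<noteq> 0"
    using linear_relation_of_large_family[OF finF] large unfolding F_def by blast
  define d where "d = (if (\<Sum>k\<in>F. c k * d0 k) \<le> 0 then d0 else (\<lambda>k. - d0 k))"
  have d: "\<And>k. k \<notin> F \<Longrightarrow> d k = 0" "(\<Sum>k\<in>F. d k *\<^sub>R a k) = 0" "\<exists>k\<in>F. d k \<noteq> 0"
    and cd: "(\<Sum>k\<in>F. c k * d k) \<le> 0"
    using d0 by (auto simp: d_def sum_negf)
  have neg: "\<exists>k\<in>F. d k < 0"
  proof (rule ccontr)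
    assume "\<not> ?thesis"
    then have ge: "\<forall>k\<in>F. 0 \<le> d k" by auto
    obtain k where "k \<in> F" "0 < d k"
      using d(3) ge by force
    then have "0 < (\<Sum>k\<in>F. c k * d k)"
      using ge pos FI finF by (intro sum_pos2[of F k]) (auto simp: subset_iff less_imp_le)
    with cd show False by simp
  qed
  \<comment> \<open>The variables that move towards a bound, and the step lengths at which they reach it.\<close>
  define S where "S = {k \<in> F. d k < 0 \<or> 0 < d k \<and> k \<in> B}"
  define r where "r k = (if d k < 0 then x k / (- d k) else (u k - x k) / d k)" for k
  have S: "finite S" "S \<noteq> {}"
    using neg finF by (auto simp: S_def)
  define t where "t = Min (r ` S)"
  have r_pos: "0 < r k" if "k \<in> S" for k
    using that F by (auto simp: S_def r_def intro!: divide_pos_neg divide_pos_pos)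
  have "t \<in> r ` S"
    unfolding t_def using S by simp
  then obtain m where m: "m \<in> S" "t = r m"
    by blast
  then have t_pos: "0 < t"
    using r_pos by simp
  have t_le: "t \<le> r k" if "k \<in> S" for k
    unfolding t_def using S that by simp
  define y where "y k = (if k \<in> F then x k + t * d k else x k)" for k
  have sumF: "(\<Sum>k\<in>I. g k) = (\<Sum>k\<in>F. g k)" if "\<And>k. k \<notin> F \<Longrightarrow> g k = 0"
    for g :: "'k \<Rightarrow> 'w::comm_monoid_add"
    using fin FI that by (intro sum.mono_neutral_right) auto
  have y_eq: "y k = x k + t * d k" for k
    by (simp add: y_def d)
  have "(\<Sum>k\<in>I. y k *\<^sub>R a k) = (\<Sum>k\<in>I. x k *\<^sub>R a k) + t *\<^sub>R (\<Sum>k\<in>I. d k *\<^sub>R a k)"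
    by (simp add: y_eq scaleR_left_distrib sum.distrib scaleR_sum_right)
  also have "(\<Sum>k\<in>I. d k *\<^sub>R a k) = 0"
    using d by (subst sumF) auto
  finally have Ay: "(\<Sum>k\<in>I. y k *\<^sub>R a k) = b"
    using x by (simp add: box_feasible_def)
  have "(\<Sum>k\<in>I. c k * y k) = (\<Sum>k\<in>I. c k * x k) + t * (\<Sum>k\<in>I. c k * d k)"
    by (simp add: y_eq algebra_simps sum.distrib sum_distrib_left)
  also have "(\<Sum>k\<in>I. c k * d k) = (\<Sum>k\<in>F. c k * d k)"
    using d by (intro sumF) auto
  finally have obj: "(\<Sum>k\<in>I. c k * y k) \<le> (\<Sum>k\<in>I. c k * x k)"
    using cd t_pos by (simp add: mult_nonneg_nonpos)
  have lower: "0 \<le> y k" if "k \<in> I" for k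
  proof (cases "k \<in> F \<and> d k < 0")
    case True
    then have "t \<le> x k / (- d k)"
      using t_le[of k] by (simp add: S_def r_def)
    then show ?thesis
      using True by (simp add: y_eq field_simps)
  next
    case False
    then have "0 \<le> d k"
      using d(1)[of k] by fastforce
    then show ?thesis
      using x t_pos that by (simp add: y_eq box_feasible_def)
  qed
  have upper: "y k \<le> u k" if "k \<in> B" for k
  proof (cases "k \<in> F \<and> 0 < d k")
    case True
    then have "t \<le> (u k - x k) / d k"
      using t_le[of k] that by (simp add: S_def r_def)
    then show ?thesis
      using True by (simp add: y_eq field_simps)
  next
    case False
    then have "d k \<le> 0"
      using d(1)[of k] by fastforce
    then have "t * d k \<le> 0"
      using t_pos by (simp add: mult_nonneg_nonpos)
    moreover have "x k \<le> u k"
      using x that by (simp add: box_feasible_def)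
    ultimately show ?thesis
      by (simp add: y_eq)
  qed
  have ext: "y \<in> extensional I"
    using x FI by (auto simp: y_def box_feasible_def extensional_def)
  have "interior_indices I B u y \<subseteq> F"
  proof
    fix k assume "k \<in> interior_indices I B u y"
    then show "k \<in> F"
      by (cases "k \<in> F") (auto simp: y_def F_def interior_indices_def)
  qed
  moreover have "m \<notin> interior_indices I B u y"
    using m by (auto simp: interior_indices_def y_eq S_def r_def)
  moreover have "m \<in> F"
    using m by (simp add: S_def)
  ultimately have "interior_indices I B u y \<subset> F"
    by blast
  then have "card (interior_indices I B u y) < card F"
    by (rule psubset_card_mono[OF finF])
  then show ?thesis
    using Ay obj lower upper ext by (intro that[of y]) (auto simp: box_feasible_def F_def)
qed

lemma basic_box_optimum:
  fixes a :: "'k \<Rightarrow> 'v::euclidean_space"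
  assumes fin: "finite I"
    and pos: "\<And>k. k \<in> I \<Longrightarrow> 0 < c k"
    and x0: "box_feasible I B u a b x0"
  obtains x where "is_arg_min (\<lambda>x. \<Sum>k\<in>I. c k * x k) (box_feasible I B u a b) x"
    "card (interior_indices I B u x) \<le> DIM('v)"
proof -
  let ?opt = "is_arg_min (\<lambda>x. \<Sum>k\<in>I. c k * x k) (box_feasible I B u a b)"
  obtain x1 where "?opt x1"
    using box_optimum_exists[where c = c, OF fin pos x0] by blast
  then obtain x where x: "?opt x"
    and least: "\<And>y. ?opt y \<Longrightarrow> card (interior_indices I B u x) \<le> card (interior_indices I B u y)"
    using ex_has_least_nat[of ?opt x1 "\<lambda>x. card (interior_indices I B u x)"] by blast
  have "\<not> DIM('v) < card (interior_indices I B u x)"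
  proof
    assume large: "DIM('v) < card (interior_indices I B u x)"
    have "box_feasible I B u a b x"
      using x by (simp add: is_arg_min_def)
    from fewer_interior_indices[where c = c, OF fin pos this large]
    obtain y where y: "box_feasible I B u a b y" "(\<Sum>k\<in>I. c k * y k) \<le> (\<Sum>k\<in>I. c k * x k)"
      "card (interior_indices I B u y) < card (interior_indices I B u x)"
      by blast
    then have "?opt y"
      using x by (auto simp: is_arg_min_linorder intro: order_trans)
    with least y(3) show False
      by (meson not_less)
  qed
  with x show ?thesis
    by (intro that[of x]) auto
qed

section \<open>The two formulations of the perturbation problem\<close>

definition lp_matrix :: "real^'n^'n \<Rightarrow> ('n \<times> 'n) set \<Rightarrow> ('n lp_var \<Rightarrow> real) \<Rightarrow> real^'n^'n" where
  "lp_matrix G \<Omega> x = Delta_zero G \<Omega> x + Delta_plus G \<Omega> x - Delta_minus G \<Omega> x"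

text \<open>No positive part is taken in the \<open>VZero\<close> block: there \<open>G\<close> vanishes, and feasibility for (P)
  makes the entry nonnegative.\<close>

definition split_matrix :: "real^'n^'n \<Rightarrow> ('n \<times> 'n) set \<Rightarrow> real^'n^'n \<Rightarrow> 'n lp_var \<Rightarrow> real" where
  "split_matrix G \<Omega> D = restrict
     (\<lambda>k. case k of VZero (i, j) \<Rightarrow> D $ i $ j
        | VPlus (i, j) \<Rightarrow> max (D $ i $ j) 0
        | VMinus (i, j) \<Rightarrow> max (- D $ i $ j) 0) (lp_index G \<Omega>)"

lemma lp_matrix_nth:
  "lp_matrix G \<Omega> x $ i $ j =
     (if (i, j) \<in> Omega_zero G \<Omega> then x (VZero (i, j))
      else if (i, j) \<in> Omega_pm G \<Omega> then x (VPlus (i, j)) - x (VMinus (i, j)) else 0)"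
  by (auto simp: lp_matrix_def Delta_zero_def Delta_plus_def Delta_minus_def
      Omega_zero_def Omega_pm_def)

lemma sum_lp_index:
  fixes f :: "'n::finite lp_var \<Rightarrow> 'v::ab_group_add"
  shows "(\<Sum>k\<in>lp_index G \<Omega>. f k) =
     (\<Sum>p\<in>Omega_zero G \<Omega>. f (VZero p)) + (\<Sum>p\<in>Omega_pm G \<Omega>. f (VPlus p) + f (VMinus p))"
proof -
  have fin: "finite (Omega_zero G \<Omega>)" "finite (Omega_pm G \<Omega>)"
    by simp_all
  have "(\<Sum>k\<in>lp_index G \<Omega>. f k) = (\<Sum>k\<in>VZero ` Omega_zero G \<Omega>. f k)
      + (\<Sum>k\<in>VPlus ` Omega_pm G \<Omega>. f k) + (\<Sum>k\<in>VMinus ` Omega_pm G \<Omega>. f k)"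
    unfolding lp_index_def using fin
    by (subst sum.union_disjoint, auto)+
  then show ?thesis
    by (simp add: sum.reindex inj_on_def sum.distrib add.assoc)
qed

lemma finite_lp_index: "finite (lp_index G \<Omega>)"
  by (simp add: lp_index_def)

lemma norm1_mat_split:
  assumes "\<And>i j. (i, j) \<notin> \<Omega> \<Longrightarrow> D $ i $ j = 0"
  shows "norm1_mat D = (\<Sum>(i, j)\<in>Omega_zero G \<Omega>. \<bar>D $ i $ j\<bar>) + (\<Sum>(i, j)\<in>Omega_pm G \<Omega>. \<bar>D $ i $ j\<bar>)"
proof -
  have in_Omega: "(i, j) \<in> \<Omega>" if "D $ i $ j \<noteq> 0" for i j
    using assms that by blast
  have "norm1_mat D = (\<Sum>(i, j)\<in>UNIV. \<bar>D $ i $ j\<bar>)"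
    by (simp add: norm1_mat_def sum.cartesian_product)
  also have "\<dots> = (\<Sum>(i, j)\<in>Omega_zero G \<Omega> \<union> Omega_pm G \<Omega>. \<bar>D $ i $ j\<bar>)"
    by (intro sum.mono_neutral_right) (auto simp: Omega_zero_def Omega_pm_def dest: in_Omega)
  also have "\<dots> = (\<Sum>(i, j)\<in>Omega_zero G \<Omega>. \<bar>D $ i $ j\<bar>) + (\<Sum>(i, j)\<in>Omega_pm G \<Omega>. \<bar>D $ i $ j\<bar>)"
    by (intro sum.union_disjoint) (auto simp: Omega_zero_def Omega_pm_def)
  finally show ?thesis .
qed

lemma LP_objective_split:
  "LP_objective G \<Omega> x = (\<Sum>p\<in>Omega_zero G \<Omega>. x (VZero p)) + (\<Sum>p\<in>Omega_pm G \<Omega>. x (VPlus p) + x (VMinus p))"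
  unfolding LP_objective_def by (rule sum_lp_index)

lemma LP_feasible_nonneg:
  assumes "LP_feasible G \<mu> \<Omega> x"
  shows "p \<in> Omega_zero G \<Omega> \<Longrightarrow> 0 \<le> x (VZero p)"
    and "p \<in> Omega_pm G \<Omega> \<Longrightarrow> 0 \<le> x (VPlus p)"
    and "p \<in> Omega_pm G \<Omega> \<Longrightarrow> 0 \<le> x (VMinus p)"
  using assms by (auto simp: LP_feasible_def lp_index_def)

lemma norm1_lp_matrix:
  assumes "LP_feasible G \<mu> \<Omega> x"
  shows "norm1_mat (lp_matrix G \<Omega> x) = (\<Sum>p\<in>Omega_zero G \<Omega>. x (VZero p))
     + (\<Sum>p\<in>Omega_pm G \<Omega>. \<bar>x (VPlus p) - x (VMinus p)\<bar>)"
proof -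
  have "norm1_mat (lp_matrix G \<Omega> x) =
      (\<Sum>(i, j)\<in>Omega_zero G \<Omega>. \<bar>lp_matrix G \<Omega> x $ i $ j\<bar>)
      + (\<Sum>(i, j)\<in>Omega_pm G \<Omega>. \<bar>lp_matrix G \<Omega> x $ i $ j\<bar>)"
    by (rule norm1_mat_split) (auto simp: lp_matrix_nth Omega_zero_def Omega_pm_def)
  also have "(\<Sum>(i, j)\<in>Omega_zero G \<Omega>. \<bar>lp_matrix G \<Omega> x $ i $ j\<bar>) = (\<Sum>p\<in>Omega_zero G \<Omega>. x (VZero p))"
    using LP_feasible_nonneg[OF assms] by (intro sum.cong) (auto simp: lp_matrix_nth)
  also have "(\<Sum>(i, j)\<in>Omega_pm G \<Omega>. \<bar>lp_matrix G \<Omega> x $ i $ j\<bar>)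
      = (\<Sum>p\<in>Omega_pm G \<Omega>. \<bar>x (VPlus p) - x (VMinus p)\<bar>)"
    by (intro sum.cong) (auto simp: lp_matrix_nth Omega_zero_def Omega_pm_def)
  finally show ?thesis .
qed

text \<open>Cancellation between \<open>x\<^sup>+\<close> and \<open>x\<^sup>-\<close> only decreases the norm.\<close>

lemma norm1_lp_matrix_le:
  assumes "LP_feasible G \<mu> \<Omega> x"
  shows "norm1_mat (lp_matrix G \<Omega> x) \<le> LP_objective G \<Omega> x"
  unfolding norm1_lp_matrix[OF assms] LP_objective_split
  using LP_feasible_nonneg[OF assms] by (intro add_mono sum_mono) force+

lemma P_feasible_lp_matrix:
  assumes G: "\<And>i j. 0 \<le> G $ i $ j" and x: "LP_feasible G \<mu> \<Omega> x"
  shows "P_feasible G \<mu> \<Omega> (lp_matrix G \<Omega> x)"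
proof -
  have "0 \<le> lp_matrix G \<Omega> x $ i $ j + G $ i $ j" for i j
  proof -
    have "x (VMinus (i, j)) \<le> G $ i $ j" if "(i, j) \<in> Omega_pm G \<Omega>"
      using x that by (auto simp: LP_feasible_def)
    then show ?thesis
      using G[of i j] LP_feasible_nonneg[OF x, of "(i, j)"] by (auto simp: lp_matrix_nth)
  qed
  then show ?thesis
    using x by (auto simp: P_feasible_def LP_feasible_def lp_matrix_nth Omega_zero_def Omega_pm_def
        simp flip: lp_matrix_def)
qed

lemma split_matrix_simps:
  "p \<in> Omega_zero G \<Omega> \<Longrightarrow> split_matrix G \<Omega> D (VZero p) = D $ fst p $ snd p"
  "p \<in> Omega_pm G \<Omega> \<Longrightarrow> split_matrix G \<Omega> D (VPlus p) = max (D $ fst p $ snd p) 0"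
  "p \<in> Omega_pm G \<Omega> \<Longrightarrow> split_matrix G \<Omega> D (VMinus p) = max (- D $ fst p $ snd p) 0"
  by (auto simp: split_matrix_def lp_index_def split: prod.splits)

lemma
  assumes G: "\<And>i j. 0 \<le> G $ i $ j" and D: "P_feasible G \<mu> \<Omega> D"
  shows LP_feasible_split_matrix: "LP_feasible G \<mu> \<Omega> (split_matrix G \<Omega> D)"
    and LP_objective_split_matrix: "LP_objective G \<Omega> (split_matrix G \<Omega> D) = norm1_mat D"
proof -
  have off: "D $ i $ j = 0" if "(i, j) \<notin> \<Omega>" for i j
    using D that by (simp add: P_feasible_def)
  have ge: "- (G $ i $ j) \<le> D $ i $ j" for i j
  proof -
    have "0 \<le> (D + G) $ i $ j"
      using D by (simp add: P_feasible_def)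
    then show ?thesis by simp
  qed
  have zero: "0 \<le> D $ i $ j" if "(i, j) \<in> Omega_zero G \<Omega>" for i j
    using ge[of i j] that by (simp add: Omega_zero_def supp_mat_def)
  have mat: "lp_matrix G \<Omega> (split_matrix G \<Omega> D) = D"
    using off by (auto simp: vec_eq_iff lp_matrix_nth split_matrix_simps Omega_zero_def Omega_pm_def)
  have "0 \<le> split_matrix G \<Omega> D k" if "k \<in> lp_index G \<Omega>" for k
    using that zero by (auto simp: lp_index_def split_matrix_simps)
  moreover have "split_matrix G \<Omega> D (VMinus (i, j)) \<le> G $ i $ j" if "(i, j) \<in> Omega_pm G \<Omega>" for i j
    using that G[of i j] ge[of i j] by (simp add: split_matrix_simps)
  moreover have "split_matrix G \<Omega> D \<in> extensional (lp_index G \<Omega>)"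
    by (simp add: split_matrix_def)
  ultimately show feas: "LP_feasible G \<mu> \<Omega> (split_matrix G \<Omega> D)"
    using D by (auto simp: LP_feasible_def P_feasible_def mat simp flip: lp_matrix_def)
  have "norm1_mat D = norm1_mat (lp_matrix G \<Omega> (split_matrix G \<Omega> D))"
    by (simp add: mat)
  also have "\<dots> = LP_objective G \<Omega> (split_matrix G \<Omega> D)"
    unfolding norm1_lp_matrix[OF feas] LP_objective_split
    by (intro arg_cong2[of _ _ _ _ "(+)"] sum.cong) (auto simp: split_matrix_simps)
  finally show "LP_objective G \<Omega> (split_matrix G \<Omega> D) = norm1_mat D" ..
qed

text \<open>Each of the two passages between (LP) and (P) does not increase the objective, so the optimal
  values agree.\<close>

lemma P_optimal_lp_matrix:
  assumes G: "\<And>i j. 0 \<le> G $ i $ j" and x: "LP_optimal G \<mu> \<Omega> x"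
  shows "P_optimal G \<mu> \<Omega> (lp_matrix G \<Omega> x)"
    and "norm1_mat (lp_matrix G \<Omega> x) = LP_objective G \<Omega> x"
proof -
  have feas: "LP_feasible G \<mu> \<Omega> x"
    and opt: "LP_feasible G \<mu> \<Omega> y \<Longrightarrow> LP_objective G \<Omega> x \<le> LP_objective G \<Omega> y" for y
    using x by (auto simp: LP_optimal_def is_arg_min_linorder)
  have lower: "LP_objective G \<Omega> x \<le> norm1_mat D" if D: "P_feasible G \<mu> \<Omega> D" for D
    using opt[OF LP_feasible_split_matrix[OF G D]] LP_objective_split_matrix[OF G D] by simp
  note feasP = P_feasible_lp_matrix[OF G feas] and le = norm1_lp_matrix_le[OF feas]
  show "norm1_mat (lp_matrix G \<Omega> x) = LP_objective G \<Omega> x"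
    using lower[OF feasP] le by simp
  show "P_optimal G \<mu> \<Omega> (lp_matrix G \<Omega> x)"
    using feasP lower le by (force simp: P_optimal_def is_arg_min_linorder)
qed

section \<open>Sizes of supports\<close>

text \<open>The cost of an optimal solution equals the norm of its matrix, so the inequality
  \<open>|x\<^sup>+ - x\<^sup>-| \<le> x\<^sup>+ + x\<^sup>-\<close>, summed over all positions, is an equality, and hence it is one at
  each position.\<close>

lemma LP_optimal_complementary:
  assumes G: "\<And>i j. 0 \<le> G $ i $ j" and x: "LP_optimal G \<mu> \<Omega> x"
    and p: "p \<in> Omega_pm G \<Omega>"
  shows "x (VPlus p) = 0 \<or> x (VMinus p) = 0"
proof -
  have feas: "LP_feasible G \<mu> \<Omega> x"
    using x by (simp add: LP_optimal_def is_arg_min_def)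
  have "(\<Sum>p\<in>Omega_pm G \<Omega>. \<bar>x (VPlus p) - x (VMinus p)\<bar>) = (\<Sum>p\<in>Omega_pm G \<Omega>. x (VPlus p) + x (VMinus p))"
    using P_optimal_lp_matrix(2)[OF G x] norm1_lp_matrix[OF feas] LP_objective_split[of G \<Omega> x]
    by simp
  moreover have "\<bar>x (VPlus q) - x (VMinus q)\<bar> \<le> x (VPlus q) + x (VMinus q)"
    if "q \<in> Omega_pm G \<Omega>" for q
    using LP_feasible_nonneg[OF feas, of q] that by linarith
  ultimately have "\<bar>x (VPlus p) - x (VMinus p)\<bar> = x (VPlus p) + x (VMinus p)"
    by (rule sum_mono_inv) (use p in simp_all)
  then show ?thesis
    by linarith
qed

definition var_position :: "'n lp_var \<Rightarrow> 'n \<times> 'n" where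
  "var_position k = (case k of VZero p \<Rightarrow> p | VPlus p \<Rightarrow> p | VMinus p \<Rightarrow> p)"

text \<open>By complementarity the nonzero variables of an optimal solution sit at different positions.\<close>

lemma card_supp_lp_le_card_Omega:
  assumes G: "\<And>i j. 0 \<le> G $ i $ j" and x: "LP_optimal G \<mu> \<Omega> x"
  shows "card (supp_lp G \<Omega> x) \<le> card \<Omega>"
proof (rule card_inj_on_le[where f = var_position])
  have "x (VMinus q) = 0" if "q \<in> \<Omega>" "q \<in> supp_mat G" "x (VPlus q) \<noteq> 0" for q
    using LP_optimal_complementary[OF G x, of q] that by (simp add: Omega_pm_def)
  then show "inj_on var_position (supp_lp G \<Omega> x)"
    by (auto simp: inj_on_def var_position_def supp_lp_def lp_index_def Omega_zero_def Omega_pm_def)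
  show "var_position ` supp_lp G \<Omega> x \<subseteq> \<Omega>"
    by (auto simp: var_position_def supp_lp_def lp_index_def Omega_zero_def Omega_pm_def)
qed simp

lemma card_supp_lp_matrix_le: "card (supp_mat (lp_matrix G \<Omega> x)) \<le> card (supp_lp G \<Omega> x)"
proof (rule surj_card_le[where f = var_position])
  show "finite (supp_lp G \<Omega> x)"
    by (simp add: supp_lp_def finite_lp_index)
  show "supp_mat (lp_matrix G \<Omega> x) \<subseteq> var_position ` supp_lp G \<Omega> x"
  proof
    fix p assume p: "p \<in> supp_mat (lp_matrix G \<Omega> x)"
    then have "VZero p \<in> supp_lp G \<Omega> x \<or> VPlus p \<in> supp_lp G \<Omega> x \<or> VMinus p \<in> supp_lp G \<Omega> x"
      by (auto simp: supp_mat_def supp_lp_def lp_index_def lp_matrix_nth split: if_splits)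
    then show "p \<in> var_position ` supp_lp G \<Omega> x"
      by (force simp: var_position_def image_iff)
  qed
qed

definition signed_unit :: "'n lp_var \<Rightarrow> real^'n^'n" where
  "signed_unit k = (case k of
       VZero (i, j) \<Rightarrow> axis i (axis j 1)
     | VPlus (i, j) \<Rightarrow> axis i (axis j 1)
     | VMinus (i, j) \<Rightarrow> - axis i (axis j 1))"

text \<open>The left-hand sides of the two systems of equality constraints. Their values live in a space of
  dimension \<open>2n\<close>, and the column of the constraint matrix that belongs to the variable \<open>k\<close> is
  \<open>marginals \<mu> (signed_unit k)\<close>.\<close>

definition marginals :: "real^'n \<Rightarrow> real^'n^'n \<Rightarrow> (real^'n) \<times> (real^'n)" where
  "marginals \<mu> M = (M *v 1, \<mu> v* M)"

lemma linear_marginals: "linear (marginals \<mu>)"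
  by (rule linearI) (simp_all add: marginals_def vec_eq_iff matrix_vector_mult_def
      vector_matrix_mult_def algebra_simps sum.distrib sum_distrib_left)

lemma sum_axis_nth:
  fixes c :: "'n::finite \<times> 'n \<Rightarrow> real"
  shows "(\<Sum>p\<in>S. c p *\<^sub>R (axis (fst p) (axis (snd p) 1) :: real^'n^'n)) $ i $ j
     = (if (i, j) \<in> S then c (i, j) else 0)"
proof -
  have "(\<Sum>p\<in>S. c p *\<^sub>R (axis (fst p) (axis (snd p) 1) :: real^'n^'n)) $ i $ j
      = (\<Sum>p\<in>S. if (i, j) = p then c p else 0)"
    unfolding sum_component by (intro sum.cong) (auto simp: axis_def)
  also have "\<dots> = (if (i, j) \<in> S then c (i, j) else 0)"
    by simp
  finally show ?thesis .
qed

lemma lp_matrix_eq_sum: "lp_matrix G \<Omega> x = (\<Sum>k\<in>lp_index G \<Omega>. x k *\<^sub>R signed_unit k)"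
proof -
  have "(\<Sum>k\<in>lp_index G \<Omega>. x k *\<^sub>R signed_unit k)
      = (\<Sum>p\<in>Omega_zero G \<Omega>. x (VZero p) *\<^sub>R axis (fst p) (axis (snd p) 1))
      + (\<Sum>p\<in>Omega_pm G \<Omega>. (x (VPlus p) - x (VMinus p)) *\<^sub>R axis (fst p) (axis (snd p) 1))"
    unfolding sum_lp_index
    by (intro arg_cong2[of _ _ _ _ "(+)"] sum.cong)
      (auto simp: signed_unit_def scaleR_left_diff_distrib)
  moreover have "Omega_zero G \<Omega> \<inter> Omega_pm G \<Omega> = {}"
    by (auto simp: Omega_zero_def Omega_pm_def)
  ultimately show ?thesis
    by (auto simp: vec_eq_iff lp_matrix_nth sum_axis_nth simp del: sum_component)
qed

text \<open>This is the upper bound \<open>\<^bold>g\<close>, which is imposed on the \<open>VMinus\<close> block only.\<close>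

definition lp_bound :: "real^'n^'n \<Rightarrow> 'n lp_var \<Rightarrow> real" where
  "lp_bound G k = G $ fst (var_position k) $ snd (var_position k)"

lemma LP_feasible_iff_box_feasible:
  "LP_feasible G \<mu> \<Omega> x \<longleftrightarrow>
     box_feasible (lp_index G \<Omega>) (VMinus ` Omega_pm G \<Omega>) (lp_bound G)
       (\<lambda>k. marginals \<mu> (signed_unit k)) (0, \<mu> v* (mat 1 - G)) x"
proof -
  have "(\<Sum>k\<in>lp_index G \<Omega>. x k *\<^sub>R marginals \<mu> (signed_unit k)) = marginals \<mu> (lp_matrix G \<Omega> x)"
    by (simp add: lp_matrix_eq_sum linear_sum[OF linear_marginals] linear_scale[OF linear_marginals])
  then show ?thesis
    by (auto simp: LP_feasible_def box_feasible_def marginals_def lp_bound_def var_position_def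
        simp flip: lp_matrix_def)
qed

text \<open>The interior variables number at most \<open>2n\<close>, and any other nonzero variable is an entry of \<open>x\<^sup>-\<close>.\<close>

lemma basic_LP_optimum:
  fixes G :: "real^'n^'n"
  assumes x0: "LP_feasible G \<mu> \<Omega> x0"
  obtains x where "LP_optimal G \<mu> \<Omega> x"
    "card (supp_lp G \<Omega> x) \<le> card (supp_mat G \<inter> \<Omega>) + 2 * CARD('n)"
proof -
  let ?I = "lp_index G \<Omega>" and ?B = "VMinus ` Omega_pm G \<Omega>"
  note basic = basic_box_optimum[OF finite_lp_index zero_less_one
      x0[unfolded LP_feasible_iff_box_feasible]]
  obtain x where x: "LP_optimal G \<mu> \<Omega> x"
    and card: "card (interior_indices ?I ?B (lp_bound G) x) \<le> DIM((real^'n) \<times> (real^'n))"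
    by (rule basic) (auto simp: LP_optimal_def LP_feasible_iff_box_feasible[abs_def]
        LP_objective_def[abs_def])
  have "LP_feasible G \<mu> \<Omega> x"
    using x by (simp add: LP_optimal_def is_arg_min_def)
  then have "supp_lp G \<Omega> x \<subseteq> interior_indices ?I ?B (lp_bound G) x \<union> ?B"
    by (force simp: supp_lp_def interior_indices_def LP_feasible_def)
  then have "card (supp_lp G \<Omega> x) \<le> card (interior_indices ?I ?B (lp_bound G) x \<union> ?B)"
    by (rule card_mono[rotated]) (simp add: interior_indices_def finite_lp_index)
  also have "\<dots> \<le> card (interior_indices ?I ?B (lp_bound G) x) + card ?B"
    by (rule card_Un_le)
  also have "card ?B = card (supp_mat G \<inter> \<Omega>)"
    by (subst card_image) (auto simp: inj_on_def Omega_pm_def Int_commute)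
  finally show ?thesis
    using card x by (intro that[of x]) auto
qed

theorem theorem3p1:
  fixes G :: "real^'n^'n" and \<mu> :: "real^'n" and \<Omega> :: "('n \<times> 'n) set"
  assumes "stochastic G"
    and "irreducible_mat G"
    and "\<forall>i. 0 < \<mu> $ i"
    and "\<mu> \<bullet> 1 = 1"
  shows "((\<exists>x. LP_feasible G \<mu> \<Omega> x) \<longrightarrow>
           (\<exists>x. LP_optimal G \<mu> \<Omega> x \<and>
              card (supp_lp G \<Omega> x) \<le> min (card \<Omega>) (card (supp_mat G \<inter> \<Omega>) + 2 * CARD('n))))
       \<and> ((\<exists>D. P_feasible G \<mu> \<Omega> D) \<longrightarrow>
           (\<exists>D. P_optimal G \<mu> \<Omega> D \<and>
              card (supp_mat D) \<le> min (card \<Omega>) (card (supp_mat G \<inter> \<Omega>) + 2 * CARD('n))))"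
proof -
  have G: "0 \<le> G $ i $ j" for i j
    using assms(1) by (simp add: stochastic_def)
  let ?m = "min (card \<Omega>) (card (supp_mat G \<inter> \<Omega>) + 2 * CARD('n))"
  have LP: "\<exists>x. LP_optimal G \<mu> \<Omega> x \<and> card (supp_lp G \<Omega> x) \<le> ?m"
    if "LP_feasible G \<mu> \<Omega> x0" for x0
    using basic_LP_optimum[OF that] card_supp_lp_le_card_Omega[OF G] by (metis min.bounded_iff)
  have P: "\<exists>D. P_optimal G \<mu> \<Omega> D \<and> card (supp_mat D) \<le> ?m" if D: "P_feasible G \<mu> \<Omega> D" for D
    using LP[OF LP_feasible_split_matrix[OF G D]] P_optimal_lp_matrix(1)[OF G]
      card_supp_lp_matrix_le order_trans by metis
  show ?thesis
    using LP P by blast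
qed

end
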